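(* Let $R$ be a nonzero ring and let $A = \prod_{i=1}^n A_i \subset R^n$ be a finite grid satisfying Condition (D), with $a_i = \#A_i$ for $i \in [n]$. Let $b_1,\dots,b_n$ be positive integers with $b_i \le a_i$ for all $i \in [n]$, and let $d \ge 0$ be an integer with $d \le \sum_{i=1}^n (a_i - b_i)$. Then the minimum weight of the generalized affine grid code $\mathrm{GAGC}_d(A;b_1,\dots,b_n)$ is \[ \mathfrak{m}\Big(a_1,\dots,a_n;\, b_1,\dots,b_n;\, \sum_{i=1}^n a_i - d\Big). \]
   Context: Rings are commutative with $1$. $[n]=\{1,\dots,n\}$. An element $r \in R$ is a zero divisor if $rs=0$ for some nonzero $s \in R$. A nonempty subset $S \subset R$ satisfies Condition (D) if for all $x \ne y$ in $S$, $x-y$ is not a zero divisor in $R$. A finite grid is a set $A=\prod_{i=1}^n A_i \subset R^n$ ($n \in \mathbb{Z}^+$) with each $A_i \subset R$ finite and nonempty; it satisfies Condition (D) if each $A_i$ does. The generalized affine grid code $\mathrm{GAGC}_d(A;b_1,\dots,b_n) \subset R^{A}$ is the set of value tables $(f(x))_{x\in A}$ of all polynomials $f \in R[t_1,\dots,t_n]$ with $\deg_{t_i} f \le a_i - b_i$ for all $i \in [n]$ and total degree $\deg f \le d$ (the zero polynomial included). The weight of a codeword is its number of nonzero entries, and the minimum weight of the code is the minimum of the weights of its nonzero codewords. For positive integers $a_1,\dots,a_n$, integers $1 \le b_i \le a_i$, and an integer $N$ with $\sum b_i \le N \le \sum a_i$, $\mathfrak{m}(a_1,\dots,a_n;b_1,\dots,b_n;N)$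 is the minimum of $\prod_{i=1}^n y_i$ over all integer tuples $(y_1,\dots,y_n)$ with $b_i \le y_i \le a_i$ for all $i$ and $\sum_{i=1}^n y_i = N$. *)

theory Defs
  imports Complex_Main "HOL-Library.Poly_Mapping" "HOL-Library.FuncSet"
begin

definition zero_divisor :: "'a::comm_ring_1 \<Rightarrow> bool" where
  "zero_divisor r \<longleftrightarrow> (\<exists>s. s \<noteq> 0 \<and> r * s = 0)"

definition condition_D :: "'a::comm_ring_1 set \<Rightarrow> bool" where
  "condition_D S \<longleftrightarrow> S \<noteq> {} \<and> (\<forall>x\<in>S. \<forall>y\<in>S. x \<noteq> y \<longrightarrow> \<not> zero_divisor (x - y))"

text \<open>Points of \<open>R\<^sup>n\<close> are functions on \<open>{1..n}\<close>, extended by \<open>undefined\<close> as in \<^const>\<open>PiE\<close>.\<close>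

definition grid :: "nat \<Rightarrow> (nat \<Rightarrow> 'a set) \<Rightarrow> (nat \<Rightarrow> 'a) set" where
  "grid n A = (\<Pi>\<^sub>E i\<in>{1..n}. A i)"

definition finite_grid :: "nat \<Rightarrow> (nat \<Rightarrow> 'a set) \<Rightarrow> bool" where
  "finite_grid n A \<longleftrightarrow> 1 \<le> n \<and> (\<forall>i\<in>{1..n}. finite (A i) \<and> A i \<noteq> {})"

definition grid_condition_D :: "nat \<Rightarrow> (nat \<Rightarrow> 'a::comm_ring_1 set) \<Rightarrow> bool" where
  "grid_condition_D n A \<longleftrightarrow> (\<forall>i\<in>{1..n}. condition_D (A i))"

text \<open>
  A polynomial maps each monomial to its coefficient, and a monomial maps each variable index
  to its exponent, both with finite support.
\<close>

type_synonym 'a mpolynomial = "(nat \<Rightarrow>\<^sub>0 nat) \<Rightarrow>\<^sub>0 'a"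

definition polynomials :: "nat \<Rightarrow> 'a::comm_ring_1 mpolynomial set" where
  "polynomials n = {f. \<forall>m\<in>Poly_Mapping.keys f. Poly_Mapping.keys m \<subseteq> {1..n}}"

definition poly_eval :: "'a::comm_ring_1 mpolynomial \<Rightarrow> (nat \<Rightarrow> 'a) \<Rightarrow> 'a" where
  "poly_eval f x = (\<Sum>m\<in>Poly_Mapping.keys f. Poly_Mapping.lookup f m *
     (\<Prod>i\<in>Poly_Mapping.keys m. x i ^ Poly_Mapping.lookup m i))"

text \<open>
  The zero polynomial gets degree 0 instead of \<open>-\<infinity>\<close>; degrees are only used in upper bounds
  by natural numbers, for which this makes no difference.
\<close>

definition degree_in :: "nat \<Rightarrow> 'a::comm_ring_1 mpolynomial \<Rightarrow> nat" where
  "degree_in i f = Max (insert 0 ((\<lambda>m. Poly_Mapping.lookup m i) ` Poly_Mapping.keys f))"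

definition total_degree :: "'a::comm_ring_1 mpolynomial \<Rightarrow> nat" where
  "total_degree f = Max (insert 0
     ((\<lambda>m. \<Sum>i\<in>Poly_Mapping.keys m. Poly_Mapping.lookup m i) ` Poly_Mapping.keys f))"

definition GAGC ::
  "nat \<Rightarrow> (nat \<Rightarrow> 'a::comm_ring_1 set) \<Rightarrow> (nat \<Rightarrow> nat) \<Rightarrow> nat \<Rightarrow> ((nat \<Rightarrow> 'a) \<Rightarrow> 'a) set" where
  "GAGC n A b d = {restrict (poly_eval f) (grid n A) | f.
     f \<in> polynomials n \<and> (\<forall>i\<in>{1..n}. degree_in i f \<le> card (A i) - b i) \<and> total_degree f \<le> d}"

text \<open>A word over the index set \<open>X\<close> is an element of \<open>X \<rightarrow>\<^sub>E UNIV\<close>.\<close>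

definition weight :: "'x set \<Rightarrow> ('x \<Rightarrow> 'a::zero) \<Rightarrow> nat" where
  "weight X c = card {x \<in> X. c x \<noteq> 0}"

definition min_weight :: "'x set \<Rightarrow> ('x \<Rightarrow> 'a::zero) set \<Rightarrow> nat" where
  "min_weight X C = Min {weight X c | c. c \<in> C \<and> c \<noteq> (\<lambda>x\<in>X. 0)}"

definition min_prod :: "nat \<Rightarrow> (nat \<Rightarrow> nat) \<Rightarrow> (nat \<Rightarrow> nat) \<Rightarrow> nat \<Rightarrow> nat" where
  "min_prod n a b N =
     Min {\<Prod>i=1..n. y i | y. y \<in> (\<Pi>\<^sub>E i\<in>{1..n}. {b i..a i}) \<and> (\<Sum>i=1..n. y i) = N}"

end

(* The lower bound is an Alon-Fueredi theorem with bounds on the degrees in the single variables,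
   proved by induction on the set of variables. If f vanishes on some slice t_i = c of the grid,
   then f = (t_i - c) g on the grid, where g has degree one less both in t_i and in total; removing
   c from A_i changes neither the number of nonzeros nor the inequality, because differences of
   elements of A_i are not zero divisors. If f vanishes on no slice t_i = c, then each of the a_i
   slices contributes at least the bound for one variable less, so y_i = a_i extends the y obtained
   from the slice with the fewest nonzeros. The bound is attained by products of linear factors
   t_i - c, with c ranging over a_i - y_i elements of A_i. *)

theory Submission
  imports Defs
begin

section \<open>Polynomial functions with degree bounds\<close>

text \<open>
  Polynomial functions with degree at most \<open>e i\<close> in the \<open>i\<close>-th variable and total degree at most
  \<open>d\<close>. Over a general ring a function does not determine its polynomial, so membership only
  asserts that some polynomial within these bounds represents the function.
\<close>

inductive_set polyfun :: "'i set \<Rightarrow> ('i \<Rightarrow> nat) \<Rightarrow> nat \<Rightarrow> (('i \<Rightarrow> 'a::comm_ring_1) \<Rightarrow> 'a) set"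
  for I :: "'i set" and e :: "'i \<Rightarrow> nat" and d :: nat where
  zero: "(\<lambda>x. 0) \<in> polyfun I e d"
| monomial: "(\<lambda>x. c * (\<Prod>i\<in>I. x i ^ m i)) \<in> polyfun I e d"
    if "\<And>i. i \<in> I \<Longrightarrow> m i \<le> e i" and "sum m I \<le> d"
| add: "(\<lambda>x. f x + g x) \<in> polyfun I e d"
    if "f \<in> polyfun I e d" and "g \<in> polyfun I e d"

lemma polyfun_mono:
  assumes "f \<in> polyfun I e d" "\<And>i. i \<in> I \<Longrightarrow> e i \<le> e' i"
  shows "f \<in> polyfun I e' d"
  using assms(1)
proof induction
  case (monomial m c)
  then show ?case
    using assms(2) by (intro polyfun.monomial) (blast intro: order_trans)+
qed (auto intro: polyfun.intros)

lemma polyfun_sum: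
  assumes "\<And>k. k \<in> K \<Longrightarrow> f k \<in> polyfun I e d"
  shows "(\<lambda>x. \<Sum>k\<in>K. f k x) \<in> polyfun I e d"
  using assms by (induction K rule: infinite_finite_induct) (auto intro: polyfun.intros)

text \<open>The power \<open>c ^ m i\<close> is absorbed into the coefficient. Monomials free of the
  \<open>i\<close>-th variable keep their total degree, so the bound \<open>d\<close> stays.\<close>

lemma polyfun_slice:
  assumes "f \<in> polyfun (insert i I) e d" "finite I" "i \<notin> I"
  shows "(\<lambda>x. f (x(i := c))) \<in> polyfun I e d"
  using assms(1)
proof induction
  case (monomial m c')
  have "(\<lambda>x. c' * (\<Prod>j\<in>insert i I. (x(i := c)) j ^ m j)) =
      (\<lambda>x. (c' * c ^ m i) * (\<Prod>j\<in>I. x j ^ m j))"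
  proof
    fix x :: "'a \<Rightarrow> 'b"
    have "(\<Prod>j\<in>I. (x(i := c)) j ^ m j) = (\<Prod>j\<in>I. x j ^ m j)"
      using assms(3) by (intro prod.cong) auto
    then show "c' * (\<Prod>j\<in>insert i I. (x(i := c)) j ^ m j) = (c' * c ^ m i) * (\<Prod>j\<in>I. x j ^ m j)"
      using assms(2,3) by (simp add: mult.assoc)
  qed
  moreover have "(\<lambda>x. (c' * c ^ m i) * (\<Prod>j\<in>I. x j ^ m j)) \<in> polyfun I e d"
    using monomial assms(2,3) by (intro polyfun.monomial) auto
  ultimately show ?case by simp
qed (auto intro: polyfun.intros)

text \<open>Monomial by monomial this is the divisibility of u^k - c^k by u - c, which holds in
  every commutative ring. The clause that \<open>g\<close> vanishes if \<open>e i = 0\<close> or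
  \<open>d = 0\<close> covers the cases where the subtraction truncates and membership alone records
  no drop in degree.\<close>

lemma polyfun_divide:
  assumes "f \<in> polyfun I e d" "finite I" "i \<in> I"
  shows "\<exists>g \<in> polyfun I (e(i := e i - 1)) (d - 1).
    (e i = 0 \<or> d = 0 \<longrightarrow> g = (\<lambda>x. 0)) \<and> (\<forall>x. f x = (x i - c) * g x + f (x(i := c)))"
  using assms(1)
proof induction
  case zero
  show ?case by (rule bexI[OF _ polyfun.zero]) auto
next
  case (monomial m c')
  \<comment> \<open>Letting the exponent of \<open>i\<close> run through all \<open>k < m i\<close>
    spells out the geometric sum, that is, the quotient of x_i^(m i) - c^(m i) by x_i - c, times the
    rest of the monomial.\<close>
  define g where "g = (\<lambda>x. \<Sum>k<m i. c' * c ^ (m i - Suc k) * (\<Prod>j\<in>I. x j ^ (m(i := k)) j))"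
  have split: "prod h I = h i * prod h (I - {i})" for h :: "'a \<Rightarrow> 'b"
    using assms(2,3) by (rule prod.remove)
  have sum_split: "sum h I = h i + sum h (I - {i})" for h :: "'a \<Rightarrow> nat"
    using assms(2,3) by (rule sum.remove)
  have "g \<in> polyfun I (e(i := e i - 1)) (d - 1)"
    unfolding g_def
  proof (intro polyfun_sum polyfun.monomial)
    fix k assume k: "k \<in> {..<m i}"
    show "(m(i := k)) j \<le> (e(i := e i - 1)) j" if "j \<in> I" for j
      using monomial(1)[OF that] k by auto
    have "sum (m(i := k)) (I - {i}) = sum m (I - {i})"
      by (intro sum.cong) auto
    then show "sum (m(i := k)) I \<le> d - 1"
      using monomial(2) k by (simp add: sum_split)
  qed
  moreover have "g = (\<lambda>x. 0)" if "e i = 0 \<or> d = 0"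
  proof -
    have "m i = 0"
      using that monomial(1)[OF assms(3)] monomial(2) assms(2,3) by auto
    then show ?thesis by (simp add: g_def)
  qed
  moreover have "c' * (\<Prod>j\<in>I. x j ^ m j) =
      (x i - c) * g x + c' * (\<Prod>j\<in>I. (x(i := c)) j ^ m j)" for x
  proof -
    define p where "p = (\<Prod>j\<in>I-{i}. x j ^ m j)"
    have p: "(\<Prod>j\<in>I. x j ^ (m(i := k)) j) = x i ^ k * p" for k
      unfolding split p_def by (auto intro!: prod.cong)
    have "(\<Prod>j\<in>I. (x(i := c)) j ^ m j) = c ^ m i * p"
      unfolding split p_def by (auto intro!: prod.cong)
    moreover have "(\<Prod>j\<in>I. x j ^ m j) = x i ^ m i * p"
      using p[of "m i"] by simp
    moreover have "(x i - c) * g x = c' * p * ((x i - c) * (\<Sum>k<m i. c ^ (m i - Suc k) * x i ^ k))"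
      unfolding g_def p by (simp add: sum_distrib_left mult_ac)
    moreover have "(x i - c) * (\<Sum>k<m i. c ^ (m i - Suc k) * x i ^ k) = x i ^ m i - c ^ m i"
      by (rule power_diff_sumr2[symmetric])
    ultimately show ?thesis by (simp only:) (simp add: algebra_simps)
  qed
  ultimately show ?case by blast
next
  case (add f1 f2)
  then obtain g1 g2 where g: "g1 \<in> polyfun I (e(i := e i - 1)) (d - 1)"
      "g2 \<in> polyfun I (e(i := e i - 1)) (d - 1)"
      "e i = 0 \<or> d = 0 \<longrightarrow> g1 = (\<lambda>x. 0)" "e i = 0 \<or> d = 0 \<longrightarrow> g2 = (\<lambda>x. 0)"
      "\<forall>x. f1 x = (x i - c) * g1 x + f1 (x(i := c))"
      "\<forall>x. f2 x = (x i - c) * g2 x + f2 (x(i := c))"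
    by blast
  show ?case
  proof (intro bexI[OF _ polyfun.add[OF g(1,2)]] conjI allI impI)
    fix x show "f1 x + f2 x = (x i - c) * (g1 x + g2 x) + (f1 (x(i := c)) + f2 (x(i := c)))"
      using g(5,6)[rule_format, of x] by (simp add: algebra_simps)
  qed (use g(3,4) in auto)
qed

text \<open>Each monomial yields two: one with the exponent of \<open>i\<close> raised by one, and
  the old one scaled by \<open>- c\<close>.\<close>

lemma polyfun_mult_linear:
  assumes "f \<in> polyfun I e d" "finite I" "i \<in> I"
  shows "(\<lambda>x. (x i - c) * f x) \<in> polyfun I (e(i := Suc (e i))) (Suc d)"
  using assms(1)
proof induction
  case (monomial m c')
  have split: "prod h I = h i * prod h (I - {i})" for h :: "'a \<Rightarrow> 'b"
    using assms(2,3) by (rule prod.remove)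
  have sum_split: "sum h I = h i + sum h (I - {i})" for h :: "'a \<Rightarrow> nat"
    using assms(2,3) by (rule sum.remove)
  have up: "(\<Prod>j\<in>I. x j ^ (m(i := Suc (m i))) j) = x i * (\<Prod>j\<in>I. x j ^ m j)" for x :: "'a \<Rightarrow> 'b"
  proof -
    have "(\<Prod>j\<in>I-{i}. x j ^ (m(i := Suc (m i))) j) = (\<Prod>j\<in>I-{i}. x j ^ m j)"
      by (intro prod.cong) auto
    then show ?thesis by (simp add: split mult_ac)
  qed
  have "sum (m(i := Suc (m i))) (I - {i}) = sum m (I - {i})"
    by (intro sum.cong) auto
  then have "sum (m(i := Suc (m i))) I \<le> Suc d"
    using monomial(2) by (simp add: sum_split)
  then have "(\<lambda>x. c' * (\<Prod>j\<in>I. x j ^ (m(i := Suc (m i))) j)) \<in> polyfun I (e(i := Suc (e i))) (Suc d)"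
    using monomial(1) assms(3) by (intro polyfun.monomial) auto
  moreover have "(\<lambda>x. - c * c' * (\<Prod>j\<in>I. x j ^ m j)) \<in> polyfun I (e(i := Suc (e i))) (Suc d)"
    using monomial(1)[THEN le_SucI] monomial by (intro polyfun.monomial) auto
  ultimately have "(\<lambda>x. c' * (\<Prod>j\<in>I. x j ^ (m(i := Suc (m i))) j) + - c * c' * (\<Prod>j\<in>I. x j ^ m j))
      \<in> polyfun I (e(i := Suc (e i))) (Suc d)"
    by (rule polyfun.add)
  then show ?case
    unfolding up by (simp add: algebra_simps fun_upd_def)
qed (auto simp: distrib_left intro: polyfun.intros)

text \<open>Starting from the constant 1, each linear factor raises by one the bound of its own
  variable and the total bound. The induction therefore counts the factors of all variables
  together.\<close>

lemma polyfun_prod_linear: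
  fixes S :: "'i \<Rightarrow> 'a::comm_ring_1 set"
  assumes "finite I" "\<And>i. i \<in> I \<Longrightarrow> finite (S i)"
  shows "(\<lambda>x. \<Prod>i\<in>I. \<Prod>c\<in>S i. x i - c) \<in> polyfun I (\<lambda>i. card (S i)) (\<Sum>i\<in>I. card (S i))"
  using assms(2)
proof (induction "\<Sum>i\<in>I. card (S i)" arbitrary: S)
  case 0
  then have S: "S i = {}" if "i \<in> I" for i
    using that assms(1) by auto
  have "(\<lambda>x. 1 * (\<Prod>i\<in>I. x i ^ (\<lambda>i. 0) i)) \<in> polyfun I (\<lambda>i. card (S i)) (\<Sum>i\<in>I. card (S i))"
    by (intro polyfun.monomial) auto
  moreover have "(\<lambda>x :: 'i \<Rightarrow> 'a. \<Prod>i\<in>I. \<Prod>c\<in>S i. x i - c) = (\<lambda>x. 1)"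
    by (simp add: S)
  ultimately show ?case by simp
next
  case (Suc k)
  then have "(\<Sum>i\<in>I. card (S i)) \<noteq> 0"
    by simp
  then obtain i where "i \<in> I" "card (S i) \<noteq> 0"
    by (rule sum.not_neutral_contains_not_neutral)
  then obtain c where i: "i \<in> I" "c \<in> S i"
    by (cases "S i = {}") auto
  define T where "T = S(i := S i - {c})"
  have fin: "finite (S i)" using Suc.prems i by simp
  have card_S: "card (S i) = Suc (card (S i - {c}))"
    using card_Suc_Diff1[OF fin i(2)] by simp
  have rest: "(\<Sum>j\<in>I-{i}. card (T j)) = (\<Sum>j\<in>I-{i}. card (S j))"
    by (intro sum.cong) (auto simp: T_def)
  have sums: "(\<Sum>j\<in>I. card (S j)) = Suc (\<Sum>j\<in>I. card (T j))"
    using rest card_S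
    by (simp add: sum.remove[OF assms(1) i(1)] T_def)
  have "(\<lambda>x. \<Prod>i\<in>I. \<Prod>c\<in>T i. x i - c) \<in> polyfun I (\<lambda>i. card (T i)) (\<Sum>i\<in>I. card (T i))"
    using Suc.hyps(2) Suc.prems sums by (intro Suc.hyps(1)) (auto simp: T_def)
  then have "(\<lambda>x. (x i - c) * (\<Prod>i\<in>I. \<Prod>c\<in>T i. x i - c))
      \<in> polyfun I ((\<lambda>i. card (T i))(i := Suc (card (T i)))) (Suc (\<Sum>i\<in>I. card (T i)))"
    by (rule polyfun_mult_linear[OF _ assms(1) i(1)])
  moreover have "(\<lambda>i. card (T i))(i := Suc (card (T i))) = (\<lambda>i. card (S i))"
    using card_S by (auto simp: T_def fun_eq_iff)
  moreover have "(x i - c) * (\<Prod>i\<in>I. \<Prod>c\<in>T i. x i - c) = (\<Prod>i\<in>I. \<Prod>c\<in>S i. x i - c)" for x :: "'i \<Rightarrow> 'a"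
  proof -
    have "(\<Prod>j\<in>I-{i}. \<Prod>c\<in>T j. x j - c) = (\<Prod>j\<in>I-{i}. \<Prod>c\<in>S j. x j - c)"
      by (intro prod.cong) (auto simp: T_def)
    then show ?thesis
      by (simp add: prod.remove[OF assms(1) i(1)] prod.remove[OF fin i(2)] T_def mult_ac)
  qed
  ultimately show ?case by (simp add: sums)
qed

section \<open>Nonzeros of products of linear factors\<close>

lemma not_zero_divisor_mult:
  "\<not> zero_divisor r \<Longrightarrow> \<not> zero_divisor s \<Longrightarrow> \<not> zero_divisor (r * s)"
  unfolding zero_divisor_def by (metis mult.assoc)

lemma not_zero_divisor_prod:
  "(\<And>k. k \<in> K \<Longrightarrow> \<not> zero_divisor (h k)) \<Longrightarrow> \<not> zero_divisor (prod h K)"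
  by (induction K rule: infinite_finite_induct)
     (auto simp: not_zero_divisor_mult zero_divisor_def[of 1])

text \<open>Since \<open>1 \<noteq> 0\<close>, the equation \<open>0 * 1 = 0\<close> makes 0 itself
  a zero divisor.\<close>

lemma not_zero_divisor_imp_nonzero: "\<not> zero_divisor r \<Longrightarrow> r \<noteq> 0"
  unfolding zero_divisor_def by (metis mult_zero_left zero_neq_one)

text \<open>A product of nonzero ring elements may vanish, so nonvanishing comes from the stronger
  property of not being a zero divisor, which is closed under products. Off \<open>S i\<close>, each
  factor \<open>x i - c\<close> is a difference of distinct elements of \<open>A i\<close>.\<close>

lemma support_prod_linear:
  fixes A S :: "'i \<Rightarrow> 'a::comm_ring_1 set"
  assumes "finite I" "\<And>i. i \<in> I \<Longrightarrow> finite (S i)" "\<And>i. i \<in> I \<Longrightarrow> S i \<subseteq> A i"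
    and "\<And>i. i \<in> I \<Longrightarrow> pairwise (\<lambda>u v. \<not> zero_divisor (u - v)) (A i)"
  shows "{x \<in> Pi\<^sub>E I A. (\<Prod>i\<in>I. \<Prod>c\<in>S i. x i - c) \<noteq> 0} = (\<Pi>\<^sub>E i\<in>I. A i - S i)"
    (is "{x \<in> _. ?f x \<noteq> 0} = _")
proof (intro equalityI subsetI)
  fix x assume x: "x \<in> {x \<in> Pi\<^sub>E I A. ?f x \<noteq> 0}"
  have "x i \<notin> S i" if i: "i \<in> I" for i
  proof
    assume "x i \<in> S i"
    then have "(\<Prod>c\<in>S i. x i - c) = 0"
      using assms(2)[OF i] by (intro prod_zero) auto
    then have "?f x = 0"
      using i assms(1) by (intro prod_zero) auto
    with x show False by simp
  qed
  with x show "x \<in> (\<Pi>\<^sub>E i\<in>I. A i - S i)"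
    by (simp add: PiE_iff)
next
  fix x assume x: "x \<in> (\<Pi>\<^sub>E i\<in>I. A i - S i)"
  have "\<not> zero_divisor (x i - c)" if i: "i \<in> I" and c: "c \<in> S i" for i c
  proof -
    have "x i \<in> A i" "x i \<noteq> c" "c \<in> A i"
      using PiE_mem[OF x i] c assms(3)[OF i] by auto
    then show ?thesis
      using assms(4)[OF i] by (simp add: pairwise_def)
  qed
  then have "?f x \<noteq> 0"
    by (intro not_zero_divisor_imp_nonzero not_zero_divisor_prod)
  with x show "x \<in> {x \<in> Pi\<^sub>E I A. ?f x \<noteq> 0}"
    by (simp add: PiE_iff)
qed

section \<open>The lower bound on the number of nonzeros\<close>

text \<open>The points are sorted into slices by their \<open>i\<close>-th coordinate;
  \<open>(z, x)\<close> corresponds to \<open>x(i := z)\<close>.\<close>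

lemma card_PiE_insert_Collect:
  assumes "finite I" "i \<notin> I" "\<And>j. j \<in> insert i I \<Longrightarrow> finite (A j)"
  shows "card {x \<in> Pi\<^sub>E (insert i I) A. P x} = (\<Sum>z\<in>A i. card {x \<in> Pi\<^sub>E I A. P (x(i := z))})"
proof -
  have fin_PiE: "finite (Pi\<^sub>E I A)"
    using assms(1,3) by (intro finite_PiE) auto
  have "bij_betw (\<lambda>(z, x). x(i := z)) (SIGMA z:A i. {x \<in> Pi\<^sub>E I A. P (x(i := z))})
      {x \<in> Pi\<^sub>E (insert i I) A. P x}"
    unfolding bij_betw_def
  proof
    have "inj_on (\<lambda>(z, x). x(i := z)) (A i \<times> Pi\<^sub>E I A)"
      using assms(2) by (rule inj_combinator)
    then show "inj_on (\<lambda>(z, x). x(i := z)) (SIGMA z:A i. {x \<in> Pi\<^sub>E I A. P (x(i := z))})"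
      by (rule inj_on_subset) auto
    show "(\<lambda>(z, x). x(i := z)) ` (SIGMA z:A i. {x \<in> Pi\<^sub>E I A. P (x(i := z))}) =
        {x \<in> Pi\<^sub>E (insert i I) A. P x}"
      unfolding PiE_insert_eq by auto
  qed
  then have "card {x \<in> Pi\<^sub>E (insert i I) A. P x} =
      card (SIGMA z:A i. {x \<in> Pi\<^sub>E I A. P (x(i := z))})"
    by (simp add: bij_betw_same_card)
  also have "\<dots> = (\<Sum>z\<in>A i. card {x \<in> Pi\<^sub>E I A. P (x(i := z))})"
    using assms(3) fin_PiE by (intro card_SigmaI) auto
  finally show ?thesis .
qed

text \<open>The sum of \<open>y\<close> is only bounded from below: passing to a slice keeps all of
  \<open>d\<close> with one variable less, so \<open>d\<close> may exceed the sum of the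
  \<open>card (A i) - b i\<close>, and then no \<open>y\<close> above \<open>b\<close> attains the
  sum exactly. The bound on \<open>e i\<close> is written with \<open>+\<close> to avoid truncated
  subtraction.\<close>

theorem alon_furedi_bounded_degrees:
  fixes A :: "'i \<Rightarrow> 'a::comm_ring_1 set"
  assumes "finite I"
    and "\<And>i. i \<in> I \<Longrightarrow> finite (A i)"
    and "\<And>i. i \<in> I \<Longrightarrow> pairwise (\<lambda>u v. \<not> zero_divisor (u - v)) (A i)"
    and "\<And>i. i \<in> I \<Longrightarrow> e i + b i \<le> card (A i)"
    and "f \<in> polyfun I e d"
    and "\<exists>x \<in> Pi\<^sub>E I A. f x \<noteq> 0"
  shows "\<exists>y. (\<forall>i\<in>I. b i \<le> y i \<and> y i \<le> card (A i)) \<and> (\<Sum>i\<in>I. card (A i)) \<le> sum y I + d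
    \<and> prod y I \<le> card {x \<in> Pi\<^sub>E I A. f x \<noteq> 0}"
  using assms
proof (induction I arbitrary: A e d f rule: finite_induct)
  case empty
  then have "{x \<in> Pi\<^sub>E {} A. f x \<noteq> 0} = {\<lambda>x. undefined}"
    by auto
  then show ?case by simp
next
  case (insert i I)
  note outer_IH = insert.IH and I = insert.hyps
  show ?case
    using insert.prems
  \<comment> \<open>Dividing by a linear factor keeps the variables and shrinks only
    \<open>A i\<close>, hence this inner induction; the outer hypothesis serves the slices.\<close>
  proof (induction "card (A i)" arbitrary: A e d f rule: less_induct)
    case less
    note fin = less.prems(1) and nzd = less.prems(2) and e = less.prems(3)
      and f = less.prems(4) and nonzero = less.prems(5)
    show ?case
    proof (cases "\<exists>c\<in>A i. \<forall>x \<in> Pi\<^sub>E I A. f (x(i := c)) = 0")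
      case True
      then obtain c where c: "c \<in> A i" and f_c: "\<And>x. x \<in> Pi\<^sub>E I A \<Longrightarrow> f (x(i := c)) = 0"
        by blast
      obtain g where g: "g \<in> polyfun (insert i I) (e(i := e i - 1)) (d - 1)"
        and g0: "e i = 0 \<or> d = 0 \<longrightarrow> g = (\<lambda>x. 0)"
        and fg: "\<And>x. f x = (x i - c) * g x + f (x(i := c))"
        using polyfun_divide[OF f finite.insertI[OF I(1)] insertI1, of c] by blast
      \<comment> \<open>The remainder is known to vanish at grid points only, so the factorization
        is claimed on the grid only.\<close>
      have f_eq: "f x = (x i - c) * g x" if x: "x \<in> Pi\<^sub>E (insert i I) A" for x
      proof -
        obtain x' z where "x' \<in> Pi\<^sub>E I A" "x = x'(i := z)"
          using x unfolding PiE_insert_eq by auto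
        then have "f (x(i := c)) = 0" using f_c[of x'] by simp
        then show ?thesis using fg[of x] by simp
      qed
      \<comment> \<open>Otherwise \<open>g\<close>, and with it \<open>f\<close> on the grid, would
        be zero. Hence \<open>e i - 1\<close> and \<open>d - 1\<close> are genuine
        decreases.\<close>
      have pos: "e i \<noteq> 0" "d \<noteq> 0"
      proof -
        obtain x where "x \<in> Pi\<^sub>E (insert i I) A" "f x \<noteq> 0"
          using nonzero by blast
        then have "g x \<noteq> 0"
          using f_eq[of x] by auto
        then show "e i \<noteq> 0" "d \<noteq> 0"
          using g0 by auto
      qed
      define B where "B = A(i := A i - {c})"
      have card_A: "card (A i) = Suc (card (B i))"
        using card_Suc_Diff1[OF fin c] by (simp add: B_def)
      have B_other: "B j = A j" if "j \<in> I" for j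
        using that I by (auto simp: B_def)
      have support: "{x \<in> Pi\<^sub>E (insert i I) A. f x \<noteq> 0} = {x \<in> Pi\<^sub>E (insert i I) B. g x \<noteq> 0}"
      proof (intro set_eqI iffI; clarify)
        fix x assume x: "x \<in> Pi\<^sub>E (insert i I) A" "f x \<noteq> 0"
        then have "x i \<noteq> c" "g x \<noteq> 0"
          using f_eq by auto
        then show "x \<in> Pi\<^sub>E (insert i I) B \<and> g x \<noteq> 0"
          using x I by (auto simp: PiE_iff B_def)
      next
        fix x assume x: "x \<in> Pi\<^sub>E (insert i I) B" "g x \<noteq> 0"
        then have xA: "x \<in> Pi\<^sub>E (insert i I) A" and "x i \<in> A i" "x i \<noteq> c"
          using I by (auto simp: PiE_iff B_def split: if_splits)
        \<comment> \<open>This is what carries \<open>g x \<noteq> 0\<close> over to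
          \<open>f x \<noteq> 0\<close>; over a general ring \<open>x i \<noteq> c\<close> would not
          suffice.\<close>
        then have "\<not> zero_divisor (x i - c)"
          using nzd[of i] c by (auto simp: pairwise_def)
        then show "x \<in> Pi\<^sub>E (insert i I) A \<and> f x \<noteq> 0"
          using x xA f_eq[OF xA] by (auto simp: zero_divisor_def)
      qed
      have "\<exists>y. (\<forall>j\<in>insert i I. b j \<le> y j \<and> y j \<le> card (B j))
          \<and> (\<Sum>j\<in>insert i I. card (B j)) \<le> sum y (insert i I) + (d - 1)
          \<and> prod y (insert i I) \<le> card {x \<in> Pi\<^sub>E (insert i I) B. g x \<noteq> 0}"
      proof (rule less.hyps)
        show "card (B i) < card (A i)" using card_A by simp
        fix j assume j: "j \<in> insert i I"
        show "finite (B j)"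
          using fin[OF j] by (cases "j = i") (simp_all add: B_def)
        show "pairwise (\<lambda>u v. \<not> zero_divisor (u - v)) (B j)"
          using nzd[OF j] by (rule pairwise_subset) (cases "j = i"; simp add: B_def Diff_subset)
        show "(e(i := e i - 1)) j + b j \<le> card (B j)"
        proof (cases "j = i")
          case True
          then show ?thesis using e[OF insertI1] pos(1) card_A by simp
        next
          case False
          then show ?thesis using e[OF j] j B_other by simp
        qed
      next
        show "\<exists>x\<in>Pi\<^sub>E (insert i I) B. g x \<noteq> 0"
          using nonzero support by blast
      qed (rule g)
      then obtain y where y: "\<And>j. j \<in> insert i I \<Longrightarrow> b j \<le> y j \<and> y j \<le> card (B j)"
          "(\<Sum>j\<in>insert i I. card (B j)) \<le> sum y (insert i I) + (d - 1)"
          "prod y (insert i I) \<le> card {x \<in> Pi\<^sub>E (insert i I) B. g x \<noteq> 0}"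
        by blast
      \<comment> \<open>Restoring \<open>c\<close> raises the sum of the cardinalities by one, and
        passing from \<open>d - 1\<close> to \<open>d\<close> compensates for it, so the same
        \<open>y\<close> serves.\<close>
      have "(\<Sum>j\<in>insert i I. card (A j)) = Suc (\<Sum>j\<in>insert i I. card (B j))"
        using I card_A by (simp add: B_other)
      then have "(\<Sum>j\<in>insert i I. card (A j)) \<le> sum y (insert i I) + d"
        using y(2) pos by linarith
      moreover have "y j \<le> card (A j)" if "j \<in> insert i I" for j
        using y(1)[OF that] card_A B_other that by (cases "j = i") auto
      ultimately show ?thesis
        using y(1,3) support by (intro exI[of _ y]) auto
    next
      case False
      then have slice: "\<exists>x \<in> Pi\<^sub>E I A. f (x(i := z)) \<noteq> 0" if "z \<in> A i" for z
        using that by blast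
      let ?N = "\<lambda>z. card {x \<in> Pi\<^sub>E I A. f (x(i := z)) \<noteq> 0}"
      have "A i \<noteq> {}"
        using nonzero by auto
      then obtain c where c: "c \<in> A i" "\<And>z. z \<in> A i \<Longrightarrow> ?N c \<le> ?N z"
        using ex_is_arg_min_if_finite[of "A i" ?N] fin[of i] unfolding is_arg_min_linorder by blast
      obtain y where y: "\<And>j. j \<in> I \<Longrightarrow> b j \<le> y j \<and> y j \<le> card (A j)"
          "(\<Sum>j\<in>I. card (A j)) \<le> sum y I + d" "prod y I \<le> ?N c"
        using outer_IH[OF _ _ _ polyfun_slice[OF f I] slice[OF c(1)]] fin nzd e by blast
      \<comment> \<open>The full value \<open>card (A i)\<close> adds the same amount to both sides
        of the sum inequality, so \<open>d\<close> is unchanged.\<close>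
      define y' where "y' = y(i := card (A i))"
      have y': "y' i = card (A i)" "\<And>j. j \<in> I \<Longrightarrow> y' j = y j"
        using I by (auto simp: y'_def)
      have "prod y' (insert i I) = card (A i) * prod y I"
        using I y' by simp
      also have "\<dots> \<le> (\<Sum>z\<in>A i. ?N c)"
        using y(3) by simp
      also have "\<dots> \<le> (\<Sum>z\<in>A i. ?N z)"
        using c(2) by (rule sum_mono)
      also have "\<dots> = card {x \<in> Pi\<^sub>E (insert i I) A. f x \<noteq> 0}"
        using card_PiE_insert_Collect[OF I fin, where P = "\<lambda>x. f x \<noteq> 0"] by simp
      finally show ?thesis
        using y(1,2) y' I e[of i] by (intro exI[of _ y']) auto
    qed
  qed
qed

section \<open>Integer tuples with prescribed sum\<close>

text \<open>A discrete intermediate value property. It lowers the tuple from the bound on nonzeros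
  to the exact sum that \<open>min_prod\<close> asks for, without going below
  \<open>b\<close>.\<close>

lemma exists_between_with_sum:
  fixes b y :: "'i \<Rightarrow> nat"
  assumes "finite I" "\<And>i. i \<in> I \<Longrightarrow> b i \<le> y i" "sum b I \<le> N" "N \<le> sum y I"
  shows "\<exists>z. (\<forall>i\<in>I. b i \<le> z i \<and> z i \<le> y i) \<and> sum z I = N"
  using assms
proof (induction I arbitrary: N rule: finite_induct)
  case empty
  then show ?case by simp
next
  case (insert i I)
  \<comment> \<open>\<open>M\<close> is the least sum that can be left to \<open>I\<close>: at least
    \<open>sum b I\<close>, and large enough that coordinate \<open>i\<close> receives at most
    \<open>y i\<close>.\<close>
  define M where "M = max (sum b I) (N - y i)"
  have le: "sum b I \<le> sum y I" "b i \<le> y i"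
    using insert.prems(1) sum_mono[of I b y] by blast+
  have N: "b i + sum b I \<le> N" "N \<le> y i + sum y I"
    using insert.hyps insert.prems(2,3) by simp_all
  have "\<exists>z. (\<forall>j\<in>I. b j \<le> z j \<and> z j \<le> y j) \<and> sum z I = M"
  proof (rule insert.IH)
    show "b j \<le> y j" if "j \<in> I" for j
      using insert.prems(1) that by simp
  qed (use le N in \<open>auto simp: M_def\<close>)
  then obtain z where z: "\<And>j. j \<in> I \<Longrightarrow> b j \<le> z j \<and> z j \<le> y j" "sum z I = M"
    by blast
  have "sum (z(i := N - M)) I = sum z I"
    using insert.hyps(2) by (intro sum.cong) auto
  then have "sum (z(i := N - M)) (insert i I) = N"
    using insert.hyps z(2) N by (simp add: M_def)
  moreover have "b i \<le> N - M" "N - M \<le> y i"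
    using le N by (auto simp: M_def)
  ultimately show ?case
    using z by (intro exI[of _ "z(i := N - M)"]) auto
qed

section \<open>From formal polynomials to polynomial functions\<close>

lemma lookup_le_degree_in: "m \<in> Poly_Mapping.keys f \<Longrightarrow> Poly_Mapping.lookup m i \<le> degree_in i f"
  unfolding degree_in_def by (intro Max_ge) auto

lemma sum_lookup_le_total_degree:
  "m \<in> Poly_Mapping.keys f \<Longrightarrow> (\<Sum>i\<in>Poly_Mapping.keys m. Poly_Mapping.lookup m i) \<le> total_degree f"
  unfolding total_degree_def by (intro Max_ge) auto

lemma degree_in_le_iff:
  "degree_in i f \<le> k \<longleftrightarrow> (\<forall>m\<in>Poly_Mapping.keys f. Poly_Mapping.lookup m i \<le> k)"
  unfolding degree_in_def by (subst Max_le_iff) auto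

lemma total_degree_le_iff:
  "total_degree f \<le> k \<longleftrightarrow>
    (\<forall>m\<in>Poly_Mapping.keys f. (\<Sum>i\<in>Poly_Mapping.keys m. Poly_Mapping.lookup m i) \<le> k)"
  unfolding total_degree_def by (subst Max_le_iff) auto

lemma poly_eval_add: "poly_eval (f + g) x = poly_eval f x + poly_eval g x"
proof -
  let ?K = "Poly_Mapping.keys f \<union> Poly_Mapping.keys g"
  let ?p = "\<lambda>m. \<Prod>i\<in>Poly_Mapping.keys m. x i ^ Poly_Mapping.lookup m i"
  \<comment> \<open>Cancellation can make the keys of \<open>f + g\<close> fewer than
    \<open>?K\<close>; the extra monomials have coefficient 0, so all three sums may run over
    \<open>?K\<close>.\<close>
  have ext: "poly_eval h x = (\<Sum>m\<in>?K. Poly_Mapping.lookup h m * ?p m)"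
    if "Poly_Mapping.keys h \<subseteq> ?K" for h
    unfolding poly_eval_def using that
    by (intro sum.mono_neutral_left) (auto simp: in_keys_iff)
  show ?thesis
    by (simp add: ext keys_add lookup_add distrib_right sum.distrib)
qed

text \<open>A polynomial is the sum of its terms; conversely, each generating rule of
  \<open>polyfun\<close> is matched by a formal polynomial. Both degree bounds are conditions on
  single monomials, so they survive addition.\<close>

lemma poly_eval_eq_polyfun:
  "{poly_eval f | f. f \<in> polynomials n \<and> (\<forall>i\<in>{1..n}. degree_in i f \<le> e i) \<and> total_degree f \<le> d}
    = polyfun {1..n} e d"
  (is "?L = _")
proof (intro equalityI subsetI)
  fix h assume "h \<in> ?L"
  then obtain f where f: "f \<in> polynomials n" "\<And>i. i \<in> {1..n} \<Longrightarrow> degree_in i f \<le> e i"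
      "total_degree f \<le> d" and h: "h = poly_eval f"
    by blast
  have "(\<lambda>x. Poly_Mapping.lookup f m * (\<Prod>i\<in>Poly_Mapping.keys m. x i ^ Poly_Mapping.lookup m i))
      \<in> polyfun {1..n} e d" if m: "m \<in> Poly_Mapping.keys f" for m
  proof -
    have sub: "Poly_Mapping.keys m \<subseteq> {1..n}"
      using f(1) m by (auto simp: polynomials_def)
    have "(\<Prod>i\<in>Poly_Mapping.keys m. x i ^ Poly_Mapping.lookup m i) =
        (\<Prod>i=1..n. x i ^ Poly_Mapping.lookup m i)" for x :: "nat \<Rightarrow> 'a"
      using sub by (intro prod.mono_neutral_left) (auto simp: in_keys_iff)
    moreover have "(\<Sum>i\<in>Poly_Mapping.keys m. Poly_Mapping.lookup m i) =
        (\<Sum>i=1..n. Poly_Mapping.lookup m i)"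
      using sub by (intro sum.mono_neutral_left) (auto simp: in_keys_iff)
    moreover have "Poly_Mapping.lookup m i \<le> e i" if "i \<in> {1..n}" for i
      using lookup_le_degree_in[OF m] f(2)[OF that] by (rule order_trans)
    ultimately show ?thesis
      using sum_lookup_le_total_degree[OF m] f(3) by (auto intro!: polyfun.monomial)
  qed
  then show "h \<in> polyfun {1..n} e d"
    unfolding h poly_eval_def[abs_def] by (rule polyfun_sum)
next
  fix h :: "(nat \<Rightarrow> 'a) \<Rightarrow> 'a" assume "h \<in> polyfun {1..n} e d"
  then show "h \<in> ?L"
  proof induction
    case zero
    have "(\<lambda>x. 0) = (poly_eval 0 :: (nat \<Rightarrow> 'a) \<Rightarrow> 'a)"
      by (simp add: poly_eval_def fun_eq_iff)
    then show ?case
      by (auto simp: polynomials_def degree_in_le_iff total_degree_le_iff intro!: exI[of _ 0])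
  next
    case (monomial m c)
    \<comment> \<open>\<open>m\<close> is arbitrary outside \<open>{1..n}\<close>; cutting it off
      there gives the finite support that an exponent vector needs.\<close>
    define m' where "m' = Abs_poly_mapping (\<lambda>i. if i \<in> {1..n} then m i else 0)"
    have "finite {i. (if i \<in> {1..n} then m i else 0) \<noteq> 0}"
      by (rule finite_subset[of _ "{1..n}"]) (auto split: if_splits)
    then have look: "Poly_Mapping.lookup m' = (\<lambda>i. if i \<in> {1..n} then m i else 0)"
      unfolding m'_def by (rule lookup_Abs_poly_mapping)
    have sub: "Poly_Mapping.keys m' \<subseteq> {1..n}"
      by (auto simp: in_keys_iff look split: if_splits)
    have prod: "(\<Prod>i\<in>Poly_Mapping.keys m'. x i ^ Poly_Mapping.lookup m' i) = (\<Prod>i=1..n. x i ^ m i)"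
      for x :: "nat \<Rightarrow> 'a"
      using sub by (intro prod.mono_neutral_cong_left) (auto simp: in_keys_iff look)
    have sum: "(\<Sum>i\<in>Poly_Mapping.keys m'. Poly_Mapping.lookup m' i) = (\<Sum>i=1..n. m i)"
      using sub by (intro sum.mono_neutral_cong_left) (auto simp: in_keys_iff look)
    let ?f = "Poly_Mapping.single m' c"
    have "(\<lambda>x. c * (\<Prod>i=1..n. x i ^ m i)) = poly_eval ?f"
      by (auto simp: poly_eval_def prod fun_eq_iff)
    moreover have "?f \<in> polynomials n"
      using sub by (auto simp: polynomials_def)
    moreover have "\<forall>i\<in>{1..n}. degree_in i ?f \<le> e i"
      using monomial(1) by (auto simp: degree_in_le_iff look)
    moreover have "total_degree ?f \<le> d"
      using monomial(2) by (auto simp: total_degree_le_iff sum)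
    ultimately show ?case
      by (intro CollectI exI[of _ ?f] conjI)
  next
    case (add h1 h2)
    then obtain f1 f2 where f: "f1 \<in> polynomials n" "f2 \<in> polynomials n"
        "\<forall>i\<in>{1..n}. degree_in i f1 \<le> e i" "\<forall>i\<in>{1..n}. degree_in i f2 \<le> e i"
        "total_degree f1 \<le> d" "total_degree f2 \<le> d" "h1 = poly_eval f1" "h2 = poly_eval f2"
      by blast
    note keys = subsetD[OF keys_add[of f1 f2]]
    have "f1 + f2 \<in> polynomials n"
      using f(1,2) keys unfolding polynomials_def by blast
    moreover have "\<forall>i\<in>{1..n}. degree_in i (f1 + f2) \<le> e i"
      using f(3,4) keys unfolding degree_in_le_iff by blast
    moreover have "total_degree (f1 + f2) \<le> d"
      using f(5,6) keys unfolding total_degree_le_iff by blast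
    moreover have "(\<lambda>x. h1 x + h2 x) = poly_eval (f1 + f2)"
      unfolding f(7,8) poly_eval_add fun_eq_iff by simp
    ultimately show ?case
      by (intro CollectI exI[of _ "f1 + f2"] conjI)
  qed
qed

section \<open>The minimum weight of the code\<close>

lemma GAGC_eq_polyfun:
  "GAGC n A b d = (\<lambda>f. restrict f (grid n A)) ` polyfun {1..n} (\<lambda>i. card (A i) - b i) d"
  unfolding GAGC_def poly_eval_eq_polyfun[symmetric] by blast

lemma weight_restrict: "weight X (restrict f X) = card {x \<in> X. f x \<noteq> 0}"
  unfolding weight_def by (rule arg_cong[of _ _ card]) auto

theorem theorem5p2:
  fixes A :: "nat \<Rightarrow> 'a::comm_ring_1 set"
    and a b :: "nat \<Rightarrow> nat"
    and n d :: nat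
  assumes "finite_grid n A"
    and "grid_condition_D n A"
    and "\<And>i. i \<in> {1..n} \<Longrightarrow> a i = card (A i)"
    and "\<And>i. i \<in> {1..n} \<Longrightarrow> 1 \<le> b i \<and> b i \<le> a i"
    and "d \<le> (\<Sum>i=1..n. a i - b i)"
  shows "min_weight (grid n A) (GAGC n A b d) = min_prod n a b ((\<Sum>i=1..n. a i) - d)"
proof -
  define N where "N = (\<Sum>i=1..n. a i) - d"
  let ?X = "grid n A" and ?e = "\<lambda>i. card (A i) - b i"
  define W where "W = {weight ?X c | c. c \<in> GAGC n A b d \<and> c \<noteq> (\<lambda>x\<in>?X. 0)}"
  define P where "P = {\<Prod>i=1..n. y i | y. y \<in> (\<Pi>\<^sub>E i\<in>{1..n}. {b i..a i}) \<and> (\<Sum>i=1..n. y i) = N}"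
  have fin: "finite (A i)" if "i \<in> {1..n}" for i
    using assms(1) that by (auto simp: finite_grid_def)
  have nzd: "pairwise (\<lambda>u v. \<not> zero_divisor (u - v)) (A i)" if "i \<in> {1..n}" for i
    using assms(2) that by (auto simp: grid_condition_D_def condition_D_def pairwise_def)
  have finX: "finite ?X"
    unfolding grid_def using fin by (intro finite_PiE) auto
  have "(\<Sum>i=1..n. a i - b i) + (\<Sum>i=1..n. b i) = (\<Sum>i=1..n. a i)"
    unfolding sum.distrib[symmetric] using assms(4) by (intro sum.cong) auto
  \<comment> \<open>The bound on \<open>d\<close> makes the subtraction in \<open>N\<close>
    exact.\<close>
  then have bN: "(\<Sum>i=1..n. b i) \<le> N" and Nd: "N + d = (\<Sum>i=1..n. a i)"
    using assms(5) by (auto simp: N_def)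
  \<comment> \<open>Lowering the coordinates of \<open>y\<close> to sum \<open>N\<close> can only
    decrease the product.\<close>
  have P_below: "\<exists>p\<in>P. p \<le> (\<Prod>i=1..n. y i)"
    if y: "\<And>i. i \<in> {1..n} \<Longrightarrow> b i \<le> y i \<and> y i \<le> a i" "N \<le> (\<Sum>i=1..n. y i)" for y
  proof -
    obtain z where z: "\<And>i. i \<in> {1..n} \<Longrightarrow> b i \<le> z i \<and> z i \<le> y i" "(\<Sum>i=1..n. z i) = N"
      using exists_between_with_sum[OF finite_atLeastAtMost _ bN y(2)] y(1) by blast
    have "(\<Prod>i=1..n. z i) \<in> P"
      unfolding P_def
    proof (intro CollectI exI conjI)
      show "restrict z {1..n} \<in> (\<Pi>\<^sub>E i\<in>{1..n}. {b i..a i})"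
        using z(1) y(1) by (fastforce intro: order_trans)
    qed (use z(2) in auto)
    moreover have "(\<Prod>i=1..n. z i) \<le> (\<Prod>i=1..n. y i)"
      using z(1) by (intro prod_mono) auto
    ultimately show ?thesis by blast
  qed
  \<comment> \<open>With \<open>P_W\<close> this makes the minima agree, although \<open>W\<close>
    may contain values outside \<open>P\<close>.\<close>
  have P_le_W: "\<exists>p\<in>P. p \<le> w" if w: "w \<in> W" for w
  proof -
    obtain f where f: "f \<in> polyfun {1..n} ?e d" "restrict f ?X \<noteq> (\<lambda>x\<in>?X. 0)"
        "w = card {x \<in> ?X. f x \<noteq> 0}"
      using w unfolding W_def GAGC_eq_polyfun by (auto simp: weight_restrict)
    have nonzero: "\<exists>x \<in> Pi\<^sub>E {1..n} A. f x \<noteq> 0"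
    proof (rule ccontr)
      assume "\<not> ?thesis"
      then have "restrict f ?X = (\<lambda>x\<in>?X. 0)"
        by (auto simp: grid_def fun_eq_iff restrict_def)
      with f(2) show False by contradiction
    qed
    have "?e i + b i \<le> card (A i)" if "i \<in> {1..n}" for i
      using assms(3,4)[OF that] by simp
    from alon_furedi_bounded_degrees[of "{1..n}" A ?e b f d,
        OF finite_atLeastAtMost fin nzd this f(1) nonzero]
    have "\<exists>y. (\<forall>i\<in>{1..n}. b i \<le> y i \<and> y i \<le> card (A i))
        \<and> (\<Sum>i=1..n. card (A i)) \<le> (\<Sum>i=1..n. y i) + d
        \<and> (\<Prod>i=1..n. y i) \<le> card {x \<in> Pi\<^sub>E {1..n} A. f x \<noteq> 0}"
      .
    then obtain y where y: "\<And>i. i \<in> {1..n} \<Longrightarrow> b i \<le> y i \<and> y i \<le> card (A i)"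
        "(\<Sum>i=1..n. card (A i)) \<le> (\<Sum>i=1..n. y i) + d"
        "(\<Prod>i=1..n. y i) \<le> card {x \<in> Pi\<^sub>E {1..n} A. f x \<noteq> 0}"
      by blast
    have ya: "b i \<le> y i \<and> y i \<le> a i" if "i \<in> {1..n}" for i
      using y(1)[OF that] assms(3)[OF that] by simp
    have "(\<Sum>i=1..n. a i) = (\<Sum>i=1..n. card (A i))"
      using assms(3) by (rule sum.cong[OF refl])
    then have "N \<le> (\<Sum>i=1..n. y i)"
      using Nd y(2) by simp
    moreover have "(\<Prod>i=1..n. y i) \<le> w"
      using y(3) f(3) by (simp add: grid_def)
    ultimately show ?thesis
      using P_below[OF ya] order_trans by blast
  qed
  \<comment> \<open>Every admissible tuple, not only a minimizing one, is realized by a product of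
    linear factors.\<close>
  have P_W: "P \<subseteq> W"
  proof
    fix p assume "p \<in> P"
    then obtain y where y_PiE: "y \<in> (\<Pi>\<^sub>E i\<in>{1..n}. {b i..a i})" and y_sum: "(\<Sum>i=1..n. y i) = N"
        and p: "p = (\<Prod>i=1..n. y i)"
      unfolding P_def by blast
    have y: "b i \<le> y i \<and> y i \<le> a i" if "i \<in> {1..n}" for i
      using PiE_mem[OF y_PiE that] by simp
    \<comment> \<open>Prescribing \<open>a i - y i\<close> roots leaves \<open>y i\<close> nonroots
      in direction \<open>i\<close>. In total this takes \<open>d\<close> linear factors, and
      \<open>b i \<le> y i\<close> gives the bound on the degree in each variable.\<close>
    have "\<exists>T. T \<subseteq> A i \<and> card T = a i - y i" if "i \<in> {1..n}" for i
      using obtain_subset_with_card_n[of "a i - y i" "A i"] assms(3)[OF that]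
      by (metis diff_le_self)
    then obtain S where S: "\<And>i. i \<in> {1..n} \<Longrightarrow> S i \<subseteq> A i \<and> card (S i) = a i - y i"
      by metis
    have finS: "finite (S i)" if "i \<in> {1..n}" for i
      using S[OF that] fin[OF that] finite_subset by blast
    let ?f = "\<lambda>x. \<Prod>i=1..n. \<Prod>c\<in>S i. x i - c"
    have "(\<Sum>i=1..n. card (S i)) + (\<Sum>i=1..n. y i) = (\<Sum>i=1..n. a i)"
      unfolding sum.distrib[symmetric]
    proof (rule sum.cong[OF refl])
      fix i assume i: "i \<in> {1..n}"
      show "card (S i) + y i = a i"
        using S[OF i] y[OF i] by simp
    qed
    then have "(\<Sum>i=1..n. card (S i)) = d"
      using y_sum Nd by simp
    then have f: "?f \<in> polyfun {1..n} (\<lambda>i. card (S i)) d"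
      using polyfun_prod_linear[of "{1..n}" S, OF finite_atLeastAtMost finS] by simp
    have "card (S i) \<le> ?e i" if "i \<in> {1..n}" for i
      unfolding assms(3)[OF that, symmetric] using S[OF that] y[OF that] by (simp add: diff_le_mono2)
    note f = polyfun_mono[of ?f _ _ _ ?e, OF f this]
    have S_sub: "S i \<subseteq> A i" if "i \<in> {1..n}" for i
      using S[OF that] by blast
    have "{x \<in> ?X. ?f x \<noteq> 0} = (\<Pi>\<^sub>E i\<in>{1..n}. A i - S i)"
      unfolding grid_def
      using support_prod_linear[of "{1..n}" S A, OF finite_atLeastAtMost finS S_sub nzd] .
    moreover have "card (A i - S i) = y i" if "i \<in> {1..n}" for i
      unfolding card_Diff_subset[OF finS[OF that] S_sub[OF that]] assms(3)[OF that, symmetric]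
      using S[OF that] y[OF that] by simp
    ultimately have wt: "weight ?X (restrict ?f ?X) = p"
      unfolding weight_restrict p by (simp add: card_PiE)
    \<comment> \<open>Positivity of \<open>b\<close> enters here: the weight \<open>p\<close> is
      positive, so the codeword is nonzero.\<close>
    have "y i \<noteq> 0" if "i \<in> {1..n}" for i
      using y[OF that] assms(4)[OF that] by simp
    then have "p \<noteq> 0"
      unfolding p by simp
    moreover have "weight ?X (\<lambda>x\<in>?X. 0 :: 'a) = 0"
      by (simp add: weight_restrict)
    ultimately have nonzero: "restrict ?f ?X \<noteq> (\<lambda>x\<in>?X. 0)"
      using wt by metis
    have "restrict ?f ?X \<in> GAGC n A b d"
      unfolding GAGC_eq_polyfun using imageI[OF f] .
    with nonzero have "weight ?X (restrict ?f ?X) \<in> W"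
      unfolding W_def by (intro CollectI exI[of _ "restrict ?f ?X"] conjI refl)
    then show "p \<in> W"
      unfolding wt .
  qed
  have "W \<subseteq> {..card ?X}"
    unfolding W_def weight_def by (auto intro!: card_mono finX)
  then have finW: "finite W"
    using finite_subset by blast
  then have finP: "finite P"
    using P_W finite_subset by blast
  \<comment> \<open>The tuple \<open>a\<close> has sum at least \<open>N\<close>, so
    \<open>P_below\<close> provides an element of \<open>P\<close>.\<close>
  have "N \<le> (\<Sum>i=1..n. a i)"
    by (simp add: N_def)
  then have "P \<noteq> {}"
    using P_below[of a] assms(4) by blast
  have "Min W = Min P"
  proof (rule antisym)
    show "Min W \<le> Min P"
      using P_W \<open>P \<noteq> {}\<close> finW by (rule Min_antimono)
    have "W \<noteq> {}"
      using P_W \<open>P \<noteq> {}\<close> by blast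
    with finW have "Min W \<in> W"
      by (rule Min_in)
    then obtain p where "p \<in> P" "p \<le> Min W"
      using P_le_W by blast
    then show "Min P \<le> Min W"
      using Min_le[OF finP] order_trans by blast
  qed
  then show ?thesis
    unfolding min_weight_def min_prod_def W_def P_def N_def .
qed

end
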